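(* Let $N_0\ge 2$ and $j>0$, and let $m^{(\mathrm{eq})}_{T,M}$ be the mean equilibrium spin of progressive quenching. For every integer $T$ with $1\le T\le N_0-1$ and every integer $M$ with $|M|\le T-1$ and $M\equiv T-1 \pmod 2$, the martingale identity $$m^{(\mathrm{eq})}_{T-1,M}=m^{(\mathrm{eq})}_{T,M+1}\,\frac{1+m^{(\mathrm{eq})}_{T-1,M}}{2}+m^{(\mathrm{eq})}_{T,M-1}\,\frac{1-m^{(\mathrm{eq})}_{T-1,M}}{2}$$ is equivalent to the local invariance of the path weight $$\left(\frac{1+m^{(\mathrm{eq})}_{T-1,M}}{2}\right)\left(\frac{1-m^{(\mathrm{eq})}_{T,M+1}}{2}\right)=\left(\frac{1-m^{(\mathrm{eq})}_{T-1,M}}{2}\right)\left(\frac{1+m^{(\mathrm{eq})}_{T,M-1}}{2}\right),$$ and consequently, the process $m^{(\mathrm{eq})}_{T,M_T}$ being a martingale, the local invariance holds. That is, in the Markov chain $(M_T)$ of progressive quenching, the paths $(T-1,M)\to(T,M+1)\to(T+1,M)$ and $(T-1,M)\to(T,M-1)\to(T+1,M)$ have the same probability weight.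
   Context: Model. $N_0$ Ising spins $s_i\in\{-1,+1\}$ sit on the complete graph with energy (inverse temperature absorbed) $H=-\frac{j}{N_0}\sum_{1\le i<k\le N_0}s_is_k$. For $0\le T\le N_0-1$ and $M\in\{-T,-T+2,\dots,T\}$, suppose that $T$ spins are quenched (frozen) with sum $M$; the $N=N_0-T$ unquenched spins $\sigma_1,\dots,\sigma_N$ are then in equilibrium with probability proportional to $$\exp\Big(\tfrac{j}{N_0}\sum_{1\le i<k\le N}\sigma_i\sigma_k+\tfrac{jM}{N_0}\sum_{i=1}^{N}\sigma_i\Big),\qquad \sigma\in\{-1,1\}^N,$$ and $m^{(\mathrm{eq})}_{T,M}$ denotes the expectation of $\sigma_1$ (equivalently, of any one unquenched spin) under this distribution. Progressive quenching (PQ). This is the Markov chain $(M_T)_{0\le T\le N_0}$ with $M_0=0$ and $M_{T+1}=M_T\pm1$, where, given $M_T=M$, the increments $+1$ and $-1$ have probabilities $\frac{1+m^{(\mathrm{eq})}_{T,M}}{2}$ and $\frac{1-m^{(\mathrm{eq})}_{T,M}}{2}$. The weight of a path segment is the product of its transition probabilities. *)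

theory Defs
  imports "HOL-Probability.Probability" "HOL-Number_Theory.Cong"
begin

text \<open>
  The unquenched spins are indexed by 1, ..., N with N = N0 - T.
\<close>

definition spin_configs :: "nat \<Rightarrow> (nat \<Rightarrow> real) set" where
  "spin_configs N = {1..N} \<rightarrow>\<^sub>E {-1, 1}"

definition boltzmann_weight :: "nat \<Rightarrow> real \<Rightarrow> nat \<Rightarrow> int \<Rightarrow> (nat \<Rightarrow> real) \<Rightarrow> real" where
  "boltzmann_weight N0 j T M \<sigma> =
     exp (j / real N0 * (\<Sum>(i, k) \<in> {(i, k). 1 \<le> i \<and> i < k \<and> k \<le> N0 - T}. \<sigma> i * \<sigma> k)
          + j * real_of_int M / real N0 * (\<Sum>i = 1..N0 - T. \<sigma> i))"

definition equilibrium_prob :: "nat \<Rightarrow> real \<Rightarrow> nat \<Rightarrow> int \<Rightarrow> (nat \<Rightarrow> real) \<Rightarrow> real" where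
  "equilibrium_prob N0 j T M \<sigma> =
     boltzmann_weight N0 j T M \<sigma> / (\<Sum>\<tau> \<in> spin_configs (N0 - T). boltzmann_weight N0 j T M \<tau>)"

definition m_eq :: "nat \<Rightarrow> real \<Rightarrow> nat \<Rightarrow> int \<Rightarrow> real" where
  "m_eq N0 j T M = (\<Sum>\<sigma> \<in> spin_configs (N0 - T). \<sigma> 1 * equilibrium_prob N0 j T M \<sigma>)"

text \<open>
  The transition law of progressive quenching at time T from state M. The library function
  \<^const>\<open>bernoulli_pmf\<close> truncates its argument to the unit interval; this has no effect here,
  since for T < N0 the mean spin lies between -1 and 1.
\<close>

definition pq_step :: "nat \<Rightarrow> real \<Rightarrow> nat \<Rightarrow> int \<Rightarrow> int pmf" where
  "pq_step N0 j T M =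
     map_pmf (\<lambda>up. if up then M + 1 else M - 1) (bernoulli_pmf ((1 + m_eq N0 j T M) / 2))"

text \<open>
  The joint law of the first states of the chain, a path being the list of its states at the
  times 0, 1, ..., T.
\<close>

primrec pq_paths :: "nat \<Rightarrow> real \<Rightarrow> nat \<Rightarrow> int list pmf" where
  "pq_paths N0 j 0 = return_pmf [0]"
| "pq_paths N0 j (Suc T) =
     bind_pmf (pq_paths N0 j T) (\<lambda>\<omega>. map_pmf (\<lambda>M'. \<omega> @ [M']) (pq_step N0 j T (last \<omega>)))"

definition pq_chain :: "nat \<Rightarrow> real \<Rightarrow> int list pmf" where
  "pq_chain N0 j = pq_paths N0 j N0"

definition pq_state :: "nat \<Rightarrow> int list \<Rightarrow> int" where
  "pq_state T \<omega> = \<omega> ! T"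

text \<open>
  The weight of the path segment that visits the states listed in xs at the times
  T, T + 1, T + 2, ...
\<close>

definition path_weight :: "nat \<Rightarrow> real \<Rightarrow> nat \<Rightarrow> int list \<Rightarrow> real" where
  "path_weight N0 j T xs =
     (\<Prod>k < length xs - 1. pmf (pq_step N0 j (T + k) (xs ! k)) (xs ! Suc k))"

definition natural_filtration :: "'a measure \<Rightarrow> (nat \<Rightarrow> 'a \<Rightarrow> int) \<Rightarrow> nat \<Rightarrow> 'a measure" where
  "natural_filtration P X t = sigma (space P) {X s -` A \<inter> space P | s A. s \<le> t}"

definition martingale_on ::
    "nat set \<Rightarrow> 'a measure \<Rightarrow> (nat \<Rightarrow> 'a measure) \<Rightarrow> (nat \<Rightarrow> 'a \<Rightarrow> real) \<Rightarrow> bool" where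
  "martingale_on I P F Y \<longleftrightarrow>
     (\<forall>t\<in>I. subalgebra P (F t)) \<and>
     (\<forall>s\<in>I. \<forall>t\<in>I. s \<le> t \<longrightarrow> sets (F s) \<subseteq> sets (F t)) \<and>
     (\<forall>t\<in>I. Y t \<in> borel_measurable (F t) \<and> integrable P (Y t)) \<and>
     (\<forall>s\<in>I. \<forall>t\<in>I. s \<le> t \<longrightarrow> (AE \<omega> in P. real_cond_exp P (F s) (Y t) \<omega> = Y s \<omega>))"

end

(*
  Quenching one more spin amounts to conditioning the equilibrium of the unquenched spins on the
  value of that spin: the Boltzmann weight at stage T with quenched sum M, at a configuration whose
  last spin is s, is exp (j M s / N0) times the weight at stage T + 1 with quenched sum M + s.  As
  spins are exchangeable, the last spin has mean m_eq, so (1 + m_eq) / 2 and (1 - m_eq) / 2 are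
  the equilibrium probabilities of s = 1 and s = -1.  The martingale identity is then the law of
  total expectation for the first spin, and the path identity is a rearrangement of it.
*)
theory Submission imports Defs begin

section \<open>Equilibrium of the unquenched spins\<close>

lemma finite_spin_configs: "finite (spin_configs N)"
  by (simp add: spin_configs_def finite_PiE)

lemma spin_configs_nonempty: "spin_configs N \<noteq> {}"
  by (simp add: spin_configs_def PiE_eq_empty_iff)

lemma spin_configs_values: "\<sigma> \<in> spin_configs N \<Longrightarrow> i \<in> {1..N} \<Longrightarrow> \<sigma> i = -1 \<or> \<sigma> i = 1"
  by (auto simp: spin_configs_def PiE_def Pi_def)

text \<open>A configuration is its last spin together with an arbitrary configuration of the others.
  The last spin is the one quenched next.\<close>

lemma sum_spin_configs_Suc:
  "(\<Sum>\<sigma>\<in>spin_configs (Suc N). f \<sigma>) =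
    (\<Sum>\<sigma>\<in>spin_configs N. f (\<sigma>(Suc N := 1))) + (\<Sum>\<sigma>\<in>spin_configs N. f (\<sigma>(Suc N := -1)))"
proof -
  let ?e = "\<lambda>(y::real, g). g(Suc N := y)"
  have eq: "spin_configs (Suc N) = ?e ` ({-1, 1} \<times> spin_configs N)"
    unfolding spin_configs_def by (simp add: atLeastAtMostSuc_conv PiE_insert_eq)
  have inj: "inj_on ?e ({-1, 1} \<times> spin_configs N)"
    unfolding spin_configs_def by (rule inj_combinator) simp
  have "(\<Sum>\<sigma>\<in>spin_configs (Suc N). f \<sigma>) = (\<Sum>p\<in>{-1, 1} \<times> spin_configs N. f (?e p))"
    by (simp add: eq sum.reindex[OF inj])
  also have "\<dots> = (\<Sum>y\<in>{-1, 1}. \<Sum>\<sigma>\<in>spin_configs N. f (\<sigma>(Suc N := y)))"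
    by (simp add: sum.cartesian_product case_prod_unfold)
  finally show ?thesis by (simp add: add.commute)
qed

text \<open>The last spin meets every other spin exactly once, so it acts on them as a field
  proportional to its value.\<close>

lemma pair_sum_Suc:
  fixes \<sigma> :: "nat \<Rightarrow> real"
  shows "(\<Sum>(i, k) \<in> {(i, k). 1 \<le> i \<and> i < k \<and> k \<le> Suc N}. \<sigma> i * \<sigma> k) =
    (\<Sum>(i, k) \<in> {(i, k). 1 \<le> i \<and> i < k \<and> k \<le> N}. \<sigma> i * \<sigma> k) + \<sigma> (Suc N) * (\<Sum>i = 1..N. \<sigma> i)"
proof -
  let ?P = "\<lambda>n. {(i, k). 1 \<le> i \<and> i < k \<and> k \<le> (n::nat)}"
  let ?Q = "(\<lambda>i. (i, Suc N)) ` {1..N}"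
  have fin: "finite (?P N)"
    by (rule finite_subset[of _ "{..N} \<times> {..N}"]) auto
  have "?P (Suc N) = ?P N \<union> ?Q" by auto
  moreover have "?P N \<inter> ?Q = {}" by auto
  ultimately have "(\<Sum>(i, k) \<in> ?P (Suc N). \<sigma> i * \<sigma> k) =
      (\<Sum>(i, k) \<in> ?P N. \<sigma> i * \<sigma> k) + (\<Sum>(i, k) \<in> ?Q. \<sigma> i * \<sigma> k)"
    using fin by (simp add: sum.union_disjoint)
  moreover have "(\<Sum>(i, k) \<in> ?Q. \<sigma> i * \<sigma> k) = \<sigma> (Suc N) * (\<Sum>i = 1..N. \<sigma> i)"
    by (subst sum.reindex) (auto simp: inj_on_def sum_distrib_left mult.commute)
  ultimately show ?thesis by simp
qed

text \<open>On the complete graph the energy depends on the spins only through their sum and their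
  sum of squares, both symmetric in the indices.\<close>

lemma pair_sum_square:
  fixes \<sigma> :: "nat \<Rightarrow> real"
  shows "2 * (\<Sum>(i, k) \<in> {(i, k). 1 \<le> i \<and> i < k \<and> k \<le> N}. \<sigma> i * \<sigma> k) =
    (\<Sum>i = 1..N. \<sigma> i)\<^sup>2 - (\<Sum>i = 1..N. (\<sigma> i)\<^sup>2)"
proof (induction N)
  case 0
  have "{(i, k). 1 \<le> i \<and> i < k \<and> k \<le> (0::nat)} = {}" by auto
  then show ?case by (simp only: sum.empty) simp
next
  case (Suc N)
  then show ?case
    unfolding pair_sum_Suc by (simp add: power2_eq_square algebra_simps)
qed

lemma boltzmann_weight_magnetization:
  assumes "(\<Sum>i = 1..N0 - T. \<sigma> i) = (\<Sum>i = 1..N0 - T. \<tau> i)"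
    and "(\<Sum>i = 1..N0 - T. (\<sigma> i)\<^sup>2) = (\<Sum>i = 1..N0 - T. (\<tau> i)\<^sup>2)"
  shows "boltzmann_weight N0 j T M \<sigma> = boltzmann_weight N0 j T M \<tau>"
  using pair_sum_square[of \<sigma> "N0 - T"] pair_sum_square[of \<tau> "N0 - T"] assms
  by (simp add: boltzmann_weight_def)

text \<open>Swapping \<open>a\<close> and \<open>b\<close> permutes the configurations and preserves
  the weight.\<close>

lemma spin_exchange:
  assumes "a \<in> {1..N0 - T}" "b \<in> {1..N0 - T}"
  shows "(\<Sum>\<sigma>\<in>spin_configs (N0 - T). \<sigma> a * boltzmann_weight N0 j T M \<sigma>) =
    (\<Sum>\<sigma>\<in>spin_configs (N0 - T). \<sigma> b * boltzmann_weight N0 j T M \<sigma>)"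
proof -
  let ?\<pi> = "Transposition.transpose a b"
  have perm: "?\<pi> permutes {1..N0 - T}"
    using assms by (rule permutes_swap_id)
  have mem: "\<sigma> \<circ> ?\<pi> \<in> spin_configs (N0 - T)" if "\<sigma> \<in> spin_configs (N0 - T)" for \<sigma>
  proof -
    \<comment> \<open>Both directions matter: inside the index set the values stay in {-1, 1},
      outside it the permuted configuration stays \<open>undefined\<close>.\<close>
    have "?\<pi> i \<in> {1..N0 - T} \<longleftrightarrow> i \<in> {1..N0 - T}" for i
      using permutes_in_image[OF perm] .
    then show ?thesis
      using that unfolding spin_configs_def PiE_iff extensional_def by auto
  qed
  have inv: "boltzmann_weight N0 j T M (\<sigma> \<circ> ?\<pi>) = boltzmann_weight N0 j T M \<sigma>" for \<sigma>
    using sum.permute[OF perm, of \<sigma>] sum.permute[OF perm, of "\<lambda>i. (\<sigma> i)\<^sup>2"]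
    by (intro boltzmann_weight_magnetization) (simp_all add: comp_def)
  show ?thesis
    \<comment> \<open>The swap is its own inverse, so it serves in both directions.\<close>
    by (rule sum.reindex_bij_witness[where i = "\<lambda>\<sigma>. \<sigma> \<circ> ?\<pi>" and j = "\<lambda>\<sigma>. \<sigma> \<circ> ?\<pi>"])
      (use mem inv in \<open>auto simp: comp_assoc\<close>)
qed

text \<open>With the last spin fixed at \<open>s\<close>, its interaction with the others shifts the
  field from \<open>M\<close> to \<open>M + s\<close>, and its own energy in the field
  \<open>M\<close> leaves a constant factor. The coupling is divided by \<open>N0\<close>, not by
  the number of unquenched spins, so the rest is exactly the weight of stage
  \<open>Suc T\<close>.\<close>

lemma boltzmann_weight_quench:
  assumes "T < N0" "s = 1 \<or> s = -1"
  shows "boltzmann_weight N0 j T M (\<sigma>(N0 - T := real_of_int s)) =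
    exp (j * real_of_int (M * s) / real N0) * boltzmann_weight N0 j (Suc T) (M + s) \<sigma>"
proof -
  define N where "N = N0 - Suc T"
  have N: "N0 - T = Suc N" using assms(1) by (simp add: N_def)
  let ?\<tau> = "\<sigma>(Suc N := real_of_int s)"
  let ?P = "{(i, k). 1 \<le> i \<and> i < k \<and> k \<le> N}"
  have pairs: "(\<Sum>(i, k)\<in>?P. ?\<tau> i * ?\<tau> k) = (\<Sum>(i, k)\<in>?P. \<sigma> i * \<sigma> k)"
    by (rule sum.cong) auto
  have single: "(\<Sum>i = 1..N. ?\<tau> i) = (\<Sum>i = 1..N. \<sigma> i)"
    by (rule sum.cong) auto
  show ?thesis
    unfolding boltzmann_weight_def N N_def[symmetric] pair_sum_Suc pairs single sum.cl_ivl_Suc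
      exp_add[symmetric]
    using single by (simp add: field_simps add_divide_distrib)
qed

section \<open>Partition function and mean spin\<close>

definition partition_fun :: "nat \<Rightarrow> real \<Rightarrow> nat \<Rightarrow> int \<Rightarrow> real" where
  "partition_fun N0 j T M = (\<Sum>\<sigma>\<in>spin_configs (N0 - T). boltzmann_weight N0 j T M \<sigma>)"

lemma partition_fun_pos: "0 < partition_fun N0 j T M"
  unfolding partition_fun_def
  by (rule sum_pos) (auto simp: finite_spin_configs spin_configs_nonempty boltzmann_weight_def)

lemma m_eq_times_partition_fun:
  "m_eq N0 j T M * partition_fun N0 j T M =
    (\<Sum>\<sigma>\<in>spin_configs (N0 - T). \<sigma> 1 * boltzmann_weight N0 j T M \<sigma>)"
  using partition_fun_pos[of N0 j T M]
  by (simp add: m_eq_def equilibrium_prob_def partition_fun_def[symmetric]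
      sum_divide_distrib[symmetric])

text \<open>An average of the values 1 and -1; \<open>T < N0\<close> ensures that index 1 carries a
  spin. The bound keeps the argument of \<open>bernoulli_pmf\<close> in the unit interval.\<close>

lemma abs_m_eq_le_1:
  assumes "T < N0"
  shows "\<bar>m_eq N0 j T M\<bar> \<le> 1"
proof -
  have "\<bar>m_eq N0 j T M * partition_fun N0 j T M\<bar> \<le> partition_fun N0 j T M"
    unfolding m_eq_times_partition_fun unfolding partition_fun_def
  proof (rule order.trans[OF sum_abs], rule sum_mono)
    fix \<sigma> assume "\<sigma> \<in> spin_configs (N0 - T)"
    then have "\<sigma> 1 = -1 \<or> \<sigma> 1 = 1"
      using spin_configs_values assms by (metis Suc_leI atLeastAtMost_iff One_nat_def le_refl zero_less_diff)
    then show "\<bar>\<sigma> 1 * boltzmann_weight N0 j T M \<sigma>\<bar> \<le> boltzmann_weight N0 j T M \<sigma>"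
      by (auto simp: boltzmann_weight_def)
  qed
  then show ?thesis
    using partition_fun_pos[of N0 j T M] by (simp add: abs_mult)
qed

text \<open>The mean of spin 1 is split by the value of the last spin; \<open>Suc T < N0\<close>
  makes these two different spins.\<close>

lemma m_eq_martingale_identity:
  assumes "Suc T < N0"
  shows "m_eq N0 j T M =
    m_eq N0 j (Suc T) (M + 1) * ((1 + m_eq N0 j T M) / 2)
    + m_eq N0 j (Suc T) (M - 1) * ((1 - m_eq N0 j T M) / 2)"
proof -
  define N where "N = N0 - Suc T"
  have N: "N0 - T = Suc N" and "1 \<le> N" using assms by (auto simp: N_def)
  define a b c where "a = m_eq N0 j T M" and "b = m_eq N0 j (Suc T) (M + 1)"
    and "c = m_eq N0 j (Suc T) (M - 1)"
  define Z where "Z = partition_fun N0 j T M"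
  \<comment> \<open>\<open>P\<close> and \<open>Q\<close> are the parts of the partition function
    \<open>Z\<close> in which the last spin is 1 and -1.\<close>
  define P where "P = exp (j * real_of_int M / real N0) * partition_fun N0 j (Suc T) (M + 1)"
  define Q where "Q = exp (- (j * real_of_int M / real N0)) * partition_fun N0 j (Suc T) (M - 1)"
  have up: "boltzmann_weight N0 j T M (\<sigma>(Suc N := 1)) =
      exp (j * real_of_int M / real N0) * boltzmann_weight N0 j (Suc T) (M + 1) \<sigma>" for \<sigma>
    using boltzmann_weight_quench[of T N0 1 j M \<sigma>] assms by (simp add: N)
  have down: "boltzmann_weight N0 j T M (\<sigma>(Suc N := -1)) =
      exp (- (j * real_of_int M / real N0)) * boltzmann_weight N0 j (Suc T) (M - 1) \<sigma>" for \<sigma>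
    using boltzmann_weight_quench[of T N0 "-1" j M \<sigma>] assms by (simp add: N)
  have Z: "Z = P + Q"
    unfolding Z_def P_def Q_def partition_fun_def N N_def[symmetric] sum_spin_configs_Suc up down
    by (simp add: sum_distrib_left)
  \<comment> \<open>Exchangeability lets the last spin stand in for spin 1, which expresses the mean
    through \<open>P\<close> and \<open>Q\<close> alone.\<close>
  have "a * Z = (\<Sum>\<sigma>\<in>spin_configs (N0 - T). \<sigma> (Suc N) * boltzmann_weight N0 j T M \<sigma>)"
    unfolding a_def Z_def m_eq_times_partition_fun
    by (rule spin_exchange) (auto simp: N)
  also have "\<dots> = P - Q"
    unfolding P_def Q_def partition_fun_def N N_def[symmetric] sum_spin_configs_Suc up down
    by (simp add: sum_distrib_left sum_negf)
  finally have last: "a * Z = P - Q" .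
  \<comment> \<open>The same mean, now through spin 1 itself, which stays unquenched because
    \<open>1 \<le> N\<close>.\<close>
  have "a * Z = exp (j * real_of_int M / real N0) * (b * partition_fun N0 j (Suc T) (M + 1))
      + exp (- (j * real_of_int M / real N0)) * (c * partition_fun N0 j (Suc T) (M - 1))"
    unfolding a_def b_def c_def Z_def m_eq_times_partition_fun N N_def[symmetric]
      sum_spin_configs_Suc up down
    using \<open>1 \<le> N\<close> by (simp add: sum_distrib_left mult.left_commute)
  then have first: "a * Z = b * P + c * Q"
    by (simp add: P_def Q_def mult.left_commute)
  \<comment> \<open>Sum and difference of \<open>P\<close> and \<open>Q\<close> are known, so
    \<open>P / Z\<close> and \<open>Q / Z\<close> are the transition probabilities.\<close>
  have "P = (1 + a) / 2 * Z" "Q = (1 - a) / 2 * Z"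
    using Z last by (simp_all add: field_simps)
  then have "a * Z = (b * ((1 + a) / 2) + c * ((1 - a) / 2)) * Z"
    using first by (simp only: distrib_right mult.assoc)
  moreover have "Z \<noteq> 0"
    using partition_fun_pos[of N0 j T M] by (simp add: Z_def)
  ultimately show ?thesis
    unfolding a_def b_def c_def by simp
qed

text \<open>Both sides, multiplied out, say
  \<open>2 * a = b * (1 + a) + c * (1 - a)\<close>.\<close>

lemma martingale_identity_iff_local_invariance:
  fixes a b c :: real
  shows "a = b * ((1 + a) / 2) + c * ((1 - a) / 2) \<longleftrightarrow>
    ((1 + a) / 2) * ((1 - b) / 2) = ((1 - a) / 2) * ((1 + c) / 2)"
  by (simp add: field_simps) argo

section \<open>The chain of progressive quenching\<close>

text \<open>\<open>M + 1\<close> and \<open>M - 1\<close> each come from one outcome of the coin,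
  and \<open>abs_m_eq_le_1\<close> rules out truncation of its bias.\<close>

lemma pmf_pq_step:
  assumes "T < N0"
  shows "pmf (pq_step N0 j T M) (M + 1) = (1 + m_eq N0 j T M) / 2"
    and "pmf (pq_step N0 j T M) (M - 1) = (1 - m_eq N0 j T M) / 2"
proof -
  let ?f = "\<lambda>up. if up then M + 1 else M - 1"
  have inj: "inj ?f" by (auto simp: inj_def)
  have "\<bar>m_eq N0 j T M\<bar> \<le> 1" using assms by (rule abs_m_eq_le_1)
  then show "pmf (pq_step N0 j T M) (M + 1) = (1 + m_eq N0 j T M) / 2"
    and "pmf (pq_step N0 j T M) (M - 1) = (1 - m_eq N0 j T M) / 2"
    using pmf_map_inj'[OF inj, of "bernoulli_pmf ((1 + m_eq N0 j T M) / 2)" True]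
      pmf_map_inj'[OF inj, of "bernoulli_pmf ((1 + m_eq N0 j T M) / 2)" False]
    by (simp_all add: pq_step_def field_simps)
qed

lemma expectation_pq_step:
  fixes f :: "int \<Rightarrow> real"
  assumes "T < N0"
  shows "measure_pmf.expectation (pq_step N0 j T M) f =
    f (M + 1) * ((1 + m_eq N0 j T M) / 2) + f (M - 1) * ((1 - m_eq N0 j T M) / 2)"
proof -
  have "\<bar>m_eq N0 j T M\<bar> \<le> 1" using assms by (rule abs_m_eq_le_1)
  then show ?thesis
    by (simp add: pq_step_def field_simps)
qed

lemma path_weight_three:
  "path_weight N0 j T [x, y, z] = pmf (pq_step N0 j T x) y * pmf (pq_step N0 j (Suc T) y) z"
  by (simp add: path_weight_def numeral_2_eq_2 lessThan_Suc mult.commute)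

section \<open>Laws of path prefixes\<close>

lemma finite_set_pq_paths: "finite (set_pmf (pq_paths N0 j T))"
  by (induction T) (auto simp: pq_step_def)

lemma length_pq_paths: "\<omega> \<in> set_pmf (pq_paths N0 j T) \<Longrightarrow> length \<omega> = Suc T"
  by (induction T arbitrary: \<omega>) auto

lemma integrable_pq_paths:
  fixes f :: "int list \<Rightarrow> real"
  shows "integrable (measure_pmf (pq_paths N0 j T)) f"
  by (rule integrable_measure_pmf_finite[OF finite_set_pq_paths])

text \<open>Later steps only append states. The prefix has length \<open>Suc t\<close> because a
  path up to time \<open>t\<close> lists \<open>t + 1\<close> states.\<close>

lemma take_pq_paths:
  assumes "t \<le> T"
  shows "map_pmf (take (Suc t)) (pq_paths N0 j T) = pq_paths N0 j t"
  using assms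
proof (induction T rule: dec_induct)
  case base
  have "map_pmf (take (Suc t)) (pq_paths N0 j t) = map_pmf (\<lambda>\<omega>. \<omega>) (pq_paths N0 j t)"
    by (rule map_pmf_cong) (auto dest: length_pq_paths)
  then show ?case by simp
next
  case (step T)
  have "map_pmf (take (Suc t)) (pq_paths N0 j (Suc T)) =
      bind_pmf (pq_paths N0 j T) (\<lambda>\<omega>. return_pmf (take (Suc t) \<omega>))"
    unfolding pq_paths.simps map_bind_pmf
  proof (rule bind_pmf_cong[OF refl])
    fix \<omega> assume "\<omega> \<in> set_pmf (pq_paths N0 j T)"
    then have "length \<omega> = Suc T" by (rule length_pq_paths)
    then show "map_pmf (take (Suc t)) (map_pmf (\<lambda>M'. \<omega> @ [M']) (pq_step N0 j T (last \<omega>))) =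
        return_pmf (take (Suc t) \<omega>)"
      using step.hyps by (simp add: pmf.map_comp comp_def)
  qed
  then show ?case
    using step.IH by (simp add: map_pmf_def)
qed

text \<open>Conditioning on the path up to time \<open>T\<close>; finite supports turn the integrals
  into sums.\<close>

lemma expectation_pq_paths_Suc:
  fixes f :: "int list \<Rightarrow> real"
  shows "measure_pmf.expectation (pq_paths N0 j (Suc T)) f =
    measure_pmf.expectation (pq_paths N0 j T)
      (\<lambda>\<omega>. measure_pmf.expectation (pq_step N0 j T (last \<omega>)) (\<lambda>M'. f (\<omega> @ [M'])))"
proof -
  have "measure_pmf.expectation (pq_paths N0 j (Suc T)) f =
      (\<Sum>\<omega>\<in>set_pmf (pq_paths N0 j T). pmf (pq_paths N0 j T) \<omega> *\<^sub>R
        measure_pmf.expectation (map_pmf (\<lambda>M'. \<omega> @ [M']) (pq_step N0 j T (last \<omega>))) f)"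
    unfolding pq_paths.simps
    by (rule pmf_expectation_bind)
      (auto simp: finite_set_pq_paths pq_step_def)
  also have "\<dots> = measure_pmf.expectation (pq_paths N0 j T)
      (\<lambda>\<omega>. measure_pmf.expectation (pq_step N0 j T (last \<omega>)) (\<lambda>M'. f (\<omega> @ [M'])))"
    by (subst integral_measure_pmf[OF finite_set_pq_paths]) simp_all
  finally show ?thesis .
qed

text \<open>Moves a quantity known at time \<open>T\<close> to the law of paths ending at
  \<open>T\<close>, where the recursion exposes the last step.\<close>

lemma expectation_pq_chain_take:
  fixes f :: "int list \<Rightarrow> real"
  assumes "T \<le> N0"
  shows "measure_pmf.expectation (pq_chain N0 j) (\<lambda>\<omega>. f (take (Suc T) \<omega>)) =
    measure_pmf.expectation (pq_paths N0 j T) f"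
  using take_pq_paths[OF assms, of N0 j]
  by (simp add: pq_chain_def flip: integral_map_pmf)

section \<open>The martingale property\<close>

lemma space_natural_filtration: "space (natural_filtration P X t) = space P"
  by (simp add: natural_filtration_def space_measure_of_conv)

lemma sets_natural_filtration:
  "sets (natural_filtration P X t) =
    sigma_sets (space P) {X s -` A \<inter> space P | s A. s \<le> t}"
  unfolding natural_filtration_def by (rule sets_measure_of) auto

lemma sets_natural_filtration_mono:
  "s \<le> t \<Longrightarrow> sets (natural_filtration P X s) \<subseteq> sets (natural_filtration P X t)"
  unfolding sets_natural_filtration by (rule sigma_sets_mono') (use le_trans in blast)

lemma measurable_natural_filtration:
  "X t \<in> measurable (natural_filtration P X t) (count_space UNIV)"
proof (rule measurableI)
  fix A
  show "X t -` A \<inter> space (natural_filtration P X t) \<in> sets (natural_filtration P X t)"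
    unfolding sets_natural_filtration space_natural_filtration
    by (rule sigma_sets.Basic) blast
qed simp

lemma subalgebra_natural_filtration_pmf:
  "subalgebra (measure_pmf p) (natural_filtration (measure_pmf p) X t)"
  by (simp add: subalgebra_def space_natural_filtration)

text \<open>A generator reads only entries at times up to \<open>t\<close>, which the prefix keeps,
  and the property passes to complements and countable unions. Measurability thus becomes a
  statement about lists.\<close>

lemma pq_filtration_determined_by_prefix:
  assumes "A \<in> sets (natural_filtration (measure_pmf p) pq_state t)"
  shows "take (Suc t) \<omega> \<in> A \<longleftrightarrow> \<omega> \<in> A"
  using assms unfolding sets_natural_filtration
  by (induction rule: sigma_sets.induct) (auto simp: pq_state_def)

text \<open>One step of the martingale property, tested on an event \<open>A\<close> decided by time
  \<open>t\<close>: averaging over the next state is the martingale identity at the current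
  one.\<close>

lemma expectation_m_eq_step:
  assumes "Suc t < N0" and A: "\<And>\<omega>. take (Suc t) \<omega> \<in> A \<longleftrightarrow> \<omega> \<in> A"
  shows "measure_pmf.expectation (pq_chain N0 j)
      (\<lambda>\<omega>. indicator A \<omega> * m_eq N0 j (Suc t) (pq_state (Suc t) \<omega>)) =
    measure_pmf.expectation (pq_chain N0 j) (\<lambda>\<omega>. indicator A \<omega> * m_eq N0 j t (pq_state t \<omega>))"
proof -
  let ?f = "\<lambda>t \<omega>. indicator A \<omega> * m_eq N0 j t (pq_state t \<omega>)"
  \<comment> \<open>An event decided by time \<open>t\<close> is also decided by time
    \<open>t + 1\<close>.\<close>
  have A': "take (Suc (Suc t)) \<omega> \<in> A \<longleftrightarrow> \<omega> \<in> A" for \<omega>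
    using A[of \<omega>] A[of "take (Suc (Suc t)) \<omega>"] by (simp add: min_def)
  \<comment> \<open>The integrands see only prefixes, so both expectations can move from the whole
    chain to shorter paths.\<close>
  have pre: "?f t \<omega> = ?f t (take (Suc t) \<omega>)"
    "?f (Suc t) \<omega> = ?f (Suc t) (take (Suc (Suc t)) \<omega>)" for \<omega>
    using A A' by (simp_all add: indicator_def pq_state_def)
  have "measure_pmf.expectation (pq_chain N0 j) (?f (Suc t)) =
      measure_pmf.expectation (pq_paths N0 j (Suc t)) (?f (Suc t))"
    using assms(1) by (subst pre(2)) (rule expectation_pq_chain_take, simp)
  also have "\<dots> = measure_pmf.expectation (pq_paths N0 j t)
      (\<lambda>\<omega>. measure_pmf.expectation (pq_step N0 j t (last \<omega>)) (\<lambda>M'. ?f (Suc t) (\<omega> @ [M'])))"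
    by (rule expectation_pq_paths_Suc)
  also have "\<dots> = measure_pmf.expectation (pq_paths N0 j t) (?f t)"
  proof (rule integral_cong_AE)
    show "AE \<omega> in pq_paths N0 j t.
      measure_pmf.expectation (pq_step N0 j t (last \<omega>)) (\<lambda>M'. ?f (Suc t) (\<omega> @ [M'])) = ?f t \<omega>"
    proof (rule AE_pmfI)
      fix \<omega> assume "\<omega> \<in> set_pmf (pq_paths N0 j t)"
      then have len: "length \<omega> = Suc t" by (rule length_pq_paths)
      \<comment> \<open>The first \<open>t + 1\<close> entries of the longer path form
        \<open>\<omega>\<close>, so the new state does not affect the event.\<close>
      have ind: "indicator A (\<omega> @ [M']) = (indicator A \<omega> :: real)" for M'
        using A[of "\<omega> @ [M']"] len by (simp add: indicator_def)
      have "last \<omega> = pq_state t \<omega>"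
        using len by (cases \<omega> rule: rev_cases) (auto simp: pq_state_def)
      moreover have "pq_state (Suc t) (\<omega> @ [M']) = M'" for M'
        using len by (simp add: pq_state_def nth_append)
      ultimately show "measure_pmf.expectation (pq_step N0 j t (last \<omega>))
          (\<lambda>M'. ?f (Suc t) (\<omega> @ [M'])) = ?f t \<omega>"
        using assms(1) m_eq_martingale_identity[OF assms(1), of j "pq_state t \<omega>"]
        by (simp add: ind expectation_pq_step)
    qed
  qed auto
  also have "\<dots> = measure_pmf.expectation (pq_chain N0 j) (?f t)"
    using assms(1) by (subst (2) pre(1)) (rule expectation_pq_chain_take[symmetric], simp)
  finally show ?thesis .
qed

text \<open>Iterates the one-step equality; \<open>A\<close> stays in the filtration as time
  grows.\<close>

lemma expectation_m_eq_constant: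
  assumes "s \<le> t" "t < N0"
    and A: "A \<in> sets (natural_filtration (measure_pmf (pq_chain N0 j)) pq_state s)"
  shows "measure_pmf.expectation (pq_chain N0 j)
      (\<lambda>\<omega>. indicator A \<omega> * m_eq N0 j t (pq_state t \<omega>)) =
    measure_pmf.expectation (pq_chain N0 j) (\<lambda>\<omega>. indicator A \<omega> * m_eq N0 j s (pq_state s \<omega>))"
  using assms(1,2)
proof (induction t rule: dec_induct)
  case (step t)
  have "A \<in> sets (natural_filtration (measure_pmf (pq_chain N0 j)) pq_state t)"
    using A sets_natural_filtration_mono[OF step.hyps(1)] by blast
  then show ?case
    using step.IH step.prems expectation_m_eq_step[OF step.prems pq_filtration_determined_by_prefix]
    by simp
qed simp

text \<open>Times stop at \<open>N0 - 1\<close>, the last at which some spin is unquenched.\<close>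

lemma martingale_m_eq:
  assumes "0 < N0"
  shows "martingale_on {0..N0 - 1} (measure_pmf (pq_chain N0 j))
    (natural_filtration (measure_pmf (pq_chain N0 j)) pq_state)
    (\<lambda>T \<omega>. m_eq N0 j T (pq_state T \<omega>))"
  unfolding martingale_on_def
proof (intro conjI ballI impI)
  let ?P = "measure_pmf (pq_chain N0 j)"
  let ?F = "natural_filtration ?P pq_state"
  let ?Y = "\<lambda>T \<omega>. m_eq N0 j T (pq_state T \<omega>)"
  show sub: "subalgebra ?P (?F t)" for t
    by (rule subalgebra_natural_filtration_pmf)
  show "sets (?F s) \<subseteq> sets (?F t)" if "s \<le> t" for s t
    using that by (rule sets_natural_filtration_mono)
  show meas: "?Y t \<in> borel_measurable (?F t)" for t
    by (rule measurable_compose[OF measurable_natural_filtration]) simp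
  show int: "integrable ?P (?Y t)" for t
    unfolding pq_chain_def by (rule integrable_pq_paths)
  fix s t assume st: "s \<in> {0..N0 - 1}" "t \<in> {0..N0 - 1}" "s \<le> t"
  interpret finite_measure_subalgebra ?P "?F s"
    by unfold_locales (rule sub)
  show "AE \<omega> in ?P. real_cond_exp ?P (?F s) (?Y t) \<omega> = ?Y s \<omega>"
  \<comment> \<open>The conditional expectation is identified by its integrals over the events of
    \<open>?F s\<close>, which \<open>expectation_m_eq_constant\<close> supplies.\<close>
  proof (rule real_cond_exp_charact)
    fix A assume "A \<in> sets (?F s)"
    then show "(\<integral>\<omega>\<in>A. ?Y t \<omega> \<partial>?P) = (\<integral>\<omega>\<in>A. ?Y s \<omega> \<partial>?P)"
      using expectation_m_eq_constant[of s t N0 A j] st assms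
      by (simp add: set_lebesgue_integral_def)
  qed (rule int int meas)+
qed

theorem mainTheorem1:
  fixes N0 :: nat and j :: real
  assumes "N0 \<ge> 2" and "j > 0"
  shows
    "(\<forall>(T::nat) (M::int). 1 \<le> T \<and> T \<le> N0 - 1 \<and> \<bar>M\<bar> \<le> int T - 1 \<and> [M = int T - 1] (mod 2) \<longrightarrow>
        (m_eq N0 j (T - 1) M =
           m_eq N0 j T (M + 1) * ((1 + m_eq N0 j (T - 1) M) / 2)
           + m_eq N0 j T (M - 1) * ((1 - m_eq N0 j (T - 1) M) / 2)
         \<longleftrightarrow>
         ((1 + m_eq N0 j (T - 1) M) / 2) * ((1 - m_eq N0 j T (M + 1)) / 2)
           = ((1 - m_eq N0 j (T - 1) M) / 2) * ((1 + m_eq N0 j T (M - 1)) / 2)))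
     \<and> martingale_on {0..N0 - 1} (measure_pmf (pq_chain N0 j))
         (natural_filtration (measure_pmf (pq_chain N0 j)) pq_state)
         (\<lambda>T \<omega>. m_eq N0 j T (pq_state T \<omega>))
     \<and> (\<forall>(T::nat) (M::int). 1 \<le> T \<and> T \<le> N0 - 1 \<and> \<bar>M\<bar> \<le> int T - 1 \<and> [M = int T - 1] (mod 2) \<longrightarrow>
        m_eq N0 j (T - 1) M =
          m_eq N0 j T (M + 1) * ((1 + m_eq N0 j (T - 1) M) / 2)
          + m_eq N0 j T (M - 1) * ((1 - m_eq N0 j (T - 1) M) / 2)
        \<and> ((1 + m_eq N0 j (T - 1) M) / 2) * ((1 - m_eq N0 j T (M + 1)) / 2)
            = ((1 - m_eq N0 j (T - 1) M) / 2) * ((1 + m_eq N0 j T (M - 1)) / 2)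
        \<and> path_weight N0 j (T - 1) [M, M + 1, M] = path_weight N0 j (T - 1) [M, M - 1, M])"
proof (intro conjI allI impI; (elim conjE)?)
  show "martingale_on {0..N0 - 1} (measure_pmf (pq_chain N0 j))
      (natural_filtration (measure_pmf (pq_chain N0 j)) pq_state)
      (\<lambda>T \<omega>. m_eq N0 j T (pq_state T \<omega>))"
    using assms(1) by (intro martingale_m_eq) simp
next
  fix T :: nat and M :: int
  show "m_eq N0 j (T - 1) M =
      m_eq N0 j T (M + 1) * ((1 + m_eq N0 j (T - 1) M) / 2)
      + m_eq N0 j T (M - 1) * ((1 - m_eq N0 j (T - 1) M) / 2)
    \<longleftrightarrow> ((1 + m_eq N0 j (T - 1) M) / 2) * ((1 - m_eq N0 j T (M + 1)) / 2)
      = ((1 - m_eq N0 j (T - 1) M) / 2) * ((1 + m_eq N0 j T (M - 1)) / 2)"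
    by (rule martingale_identity_iff_local_invariance)
next
  fix T :: nat and M :: int
  assume "1 \<le> T" "T \<le> N0 - 1"
  \<comment> \<open>The first transition starts at time \<open>T - 1\<close> and the second at
    \<open>T\<close>; both times must lie below \<open>N0\<close>.\<close>
  then have T: "Suc (T - 1) = T" "T < N0" "T - 1 < N0" using assms(1) by auto
  show mart: "m_eq N0 j (T - 1) M =
      m_eq N0 j T (M + 1) * ((1 + m_eq N0 j (T - 1) M) / 2)
      + m_eq N0 j T (M - 1) * ((1 - m_eq N0 j (T - 1) M) / 2)"
    using m_eq_martingale_identity[of "T - 1" N0 j M] T by simp
  then show inv: "((1 + m_eq N0 j (T - 1) M) / 2) * ((1 - m_eq N0 j T (M + 1)) / 2)
      = ((1 - m_eq N0 j (T - 1) M) / 2) * ((1 + m_eq N0 j T (M - 1)) / 2)"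
    by (rule martingale_identity_iff_local_invariance[THEN iffD1])
  show "path_weight N0 j (T - 1) [M, M + 1, M] = path_weight N0 j (T - 1) [M, M - 1, M]"
    unfolding path_weight_three T(1)
    \<comment> \<open>The return to \<open>M\<close> is a step down from \<open>M + 1\<close> or a
      step up from \<open>M - 1\<close>; the \<open>unfolded\<close> attributes simplify the targets
      \<open>M + 1 - 1\<close> and \<open>M - 1 + 1\<close> to \<open>M\<close>.\<close>
    using inv by (simp only: pmf_pq_step[OF T(3)]
        pmf_pq_step(2)[OF T(2), of j "M + 1", unfolded add_diff_cancel_right']
        pmf_pq_step(1)[OF T(2), of j "M - 1", unfolded diff_add_cancel])
qed

end
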